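(* Let $L\in\mathbb{N}$, $H=\lfloor L/2\rfloor$, and let $n\ge 0$ and $0\le k\le H$ be integers. Let $G_n(k)$ be the set of forward paths of length $n$ in $\mathcal{T}_L$ starting at $\mathcal{O}+ks_1$ (with $G_n(k)=\emptyset$ for $k<0$), and let $M_n(k)$ be the set of Motzkin meanders of length $n$ starting at height $k$ and having amplitude bounded by $L$. Then the recursively defined function $\Omega_{n,k}$ (see context) is a bijection from $G_n(k)$ to the disjoint union $M_n(k)\cup G_n(k-1)$.
   Context: $\mathbb{N}=\{0,1,2,\dots\}$ and $(e_1,e_2,e_3)$ is the standard basis of $\mathbb{R}^3$. $\mathcal{T}_L=\{x_1e_1+x_2e_2+x_3e_3 : x_1,x_2,x_3\in\mathbb{N},\ x_1+x_2+x_3=L\}$, $\mathcal{O}=Le_3$. Forward steps: $s_1=e_1-e_3$, $s_2=e_2-e_1$, $s_3=e_3-e_2$; backward steps $\overline{s_i}=-s_i$; indices modulo $3$ (so $s_0=s_3$). A triangular path of length $n$ from $z\in\mathcal{T}_L$ is a sequence $(\omega_1,\dots,\omega_n)$ of forward or backward steps with $z+\sum_{i=1}^j\omega_i\in\mathcal{T}_L$ for all $j\in\{0,\dots,n\}$; it is a forward path if all its steps are forward. The direction vector of a path records, for each step, $F$ (forward) or $B$ (backward). Motzkin meanders: sequences of steps $\nearrow$ (height $+1$), $\rightarrow$ (height $+0$), $\searrow$ (height $-1$) that start at some height $\ge0$, stay at height $\ge 0$ and end at height $0$. The amplitude of a meander with maximum height $h$ (starting height included) is $2h+1$ if a step $\rightarrow$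 is performed at height $h$, and $2h$ otherwise; "bounded by $L$" means $\le L$. The map $W_n$. A swap flip replaces two consecutive steps according to the reversible rules $(s_j,\overline{s_k})\leftrightarrow(\overline{s_k},s_j)$ for $j\ne k$ and $(s_k,\overline{s_k})\leftrightarrow(\overline{s_{k-1}},s_{k-1})$; a last-step flip changes the last step by the reversible rule $s_i\leftrightarrow\overline{s_{i-1}}$. For a triangular path $\omega$ of length $n$ starting at $z$, $W_n(\omega)$ is the forward path of length $n$ starting at $z$ obtained from $\omega$ by successive flips until all steps are forward (the result does not depend on the sequence of flips; for each fixed direction vector, $W_n$ is a bijection from paths from $z$ with this direction vector to forward paths from $z$). Definition of $\Omega_{n,k}$ by recursion on $n$. For $n=0$: $\Omega_{0,0}$ sends the empty path to the empty meander, and for $k\ge1$, $\Omega_{0,k}$ sends the empty path starting at $\mathcal{O}+ks_1$ to the empty path starting at $\mathcal{O}+(k-1)s_1$. For $n\ge 1$ and $\omega\in G_n(k)$, let $\omega'$ be $\omega$ without its first step (the first step is necessarily $s_1$ or $s_2$). (a) If the first step is $s_2$, output $W_n$ of the path consisting of $\overline{s_3}$ followed by $\omega'$, viewed as a path starting at $\mathcal{O}+(k-1)s_1$. (b) If the first step is $s_1$ and $k<H$: compute $\Omega_{n-1,k+1}(\omega')$. If it is a meander $m$, output $\nearrow$ followed by $m$. Otherwise it is a path $u\in G_{n-1}(k)$; go to (d) with $u$. (c) If the first step is $s_1$ and $k=H$: replace in $\omega'$ each step $s_1,s_2,s_3$ by $\overline{s_1},\overline{s_3},\overline{s_2}$ respectively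 (reflection exchanging $e_1$ and $e_3$) and apply $W_{n-1}$ to get $\rho$, which lies in $G_{n-1}(H)$ if $L$ is odd and in $G_{n-1}(H-1)$ if $L$ is even. If $L$ is odd go to (d) with $u=\rho$; if $L$ is even go to (e) with $v=\rho$. (d) Compute $\Omega_{n-1,k}(u)$. If it is a meander $m$, output $\rightarrow$ followed by $m$. Otherwise it is a path $v\in G_{n-1}(k-1)$; go to (e) with $v$. (e) Compute $\Omega_{n-1,k-1}(v)$. If it is a meander $m$, output $\searrow$ followed by $m$. Otherwise it is a path $w\in G_{n-1}(k-2)$; output $W_n$ of the path consisting of $\overline{s_1}$ followed by $w$, viewed as a path starting at $\mathcal{O}+(k-1)s_1$. *)

theory Defs
  imports "HOL-Analysis.Analysis"
begin

(* The index type 3 is the ring of integers modulo 3 (so 3 = 0), hence s_0 = s_3 and index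
   arithmetic modulo 3 is ordinary arithmetic in this type.  Only lattice points of R^3 occur,
   so vectors are taken in int ^ 3. *)

definition unit_vec :: "3 \<Rightarrow> int ^ 3" where
  "unit_vec i = axis i 1"

definition tri :: "nat \<Rightarrow> (int ^ 3) set" where
  "tri L = {int x1 *s unit_vec 1 + int x2 *s unit_vec 2 + int x3 *s unit_vec 3 | x1 x2 x3.
     x1 + x2 + x3 = L}"

(* s_1 = e_1 - e_3, s_2 = e_2 - e_1, s_3 = e_3 - e_2 *)
definition fwd_vec :: "3 \<Rightarrow> int ^ 3" where
  "fwd_vec i = unit_vec i - unit_vec (i - 1)"

(* The six step vectors are pairwise distinct, so steps are represented by their names:
   Fwd i stands for s_i and Bwd i for the opposite vector. *)
datatype step = Fwd 3 | Bwd 3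

fun step_vec :: "step \<Rightarrow> int ^ 3" where
  "step_vec (Fwd i) = fwd_vec i"
| "step_vec (Bwd i) = - fwd_vec i"

fun is_fwd :: "step \<Rightarrow> bool" where
  "is_fwd (Fwd i) = True"
| "is_fwd (Bwd i) = False"

definition tri_path :: "nat \<Rightarrow> int ^ 3 \<Rightarrow> step list \<Rightarrow> bool" where
  "tri_path L z p \<longleftrightarrow>
     (\<forall>j\<in>{0..length p}. z + sum_list (map step_vec (take j p)) \<in> tri L)"

definition fwd_path :: "nat \<Rightarrow> int ^ 3 \<Rightarrow> step list \<Rightarrow> bool" where
  "fwd_path L z p \<longleftrightarrow> tri_path L z p \<and> (\<forall>s\<in>set p. is_fwd s)"

(* O + k s_1, where O = L e_3 *)
definition start_pt :: "nat \<Rightarrow> int \<Rightarrow> int ^ 3" where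
  "start_pt L k = int L *s unit_vec 3 + k *s fwd_vec 1"

(* For k < 0 the start point lies outside the triangle, so this set is empty
   (lemma fwd_paths_neg below). *)
definition fwd_paths :: "nat \<Rightarrow> nat \<Rightarrow> int \<Rightarrow> step list set" where
  "fwd_paths L n k = {p. length p = n \<and> fwd_path L (start_pt L k) p}"

(* One direction of each flip; reversibility is the symmetric closure taken in flip. *)
inductive flip1 :: "step list \<Rightarrow> step list \<Rightarrow> bool" where
  swap_diff: "j \<noteq> k \<Longrightarrow> flip1 (p @ [Fwd j, Bwd k] @ q) (p @ [Bwd k, Fwd j] @ q)"
| swap_same: "flip1 (p @ [Fwd k, Bwd k] @ q) (p @ [Bwd (k - 1), Fwd (k - 1)] @ q)"
| last_step: "flip1 (p @ [Fwd i]) (p @ [Bwd (i - 1)])"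

definition flip :: "step list \<Rightarrow> step list \<Rightarrow> bool" where
  "flip p q \<longleftrightarrow> flip1 p q \<or> flip1 q p"

(* The map W_n (n = length p).  No start point is needed: flips do not mention it, and they
   send triangular paths from z to triangular paths from z. *)
definition flip_to_fwd :: "step list \<Rightarrow> step list" where
  "flip_to_fwd p = (THE q. flip\<^sup>*\<^sup>* p q \<and> (\<forall>s\<in>set q. is_fwd s))"

datatype mstep = Up | Level | Down

fun mstep_height :: "mstep \<Rightarrow> int" where
  "mstep_height Up = 1"
| "mstep_height Level = 0"
| "mstep_height Down = - 1"

definition height_at :: "int \<Rightarrow> mstep list \<Rightarrow> nat \<Rightarrow> int" where
  "height_at k m j = k + sum_list (map mstep_height (take j m))"

definition meander :: "int \<Rightarrow> mstep list \<Rightarrow> bool" where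
  "meander k m \<longleftrightarrow>
     (\<forall>j\<in>{0..length m}. 0 \<le> height_at k m j) \<and> height_at k m (length m) = 0"

definition max_height :: "int \<Rightarrow> mstep list \<Rightarrow> int" where
  "max_height k m = Max (height_at k m ` {0..length m})"

definition amplitude :: "int \<Rightarrow> mstep list \<Rightarrow> int" where
  "amplitude k m =
     (if \<exists>j<length m. m ! j = Level \<and> height_at k m j = max_height k m
      then 2 * max_height k m + 1 else 2 * max_height k m)"

definition meanders :: "nat \<Rightarrow> nat \<Rightarrow> int \<Rightarrow> mstep list set" where
  "meanders L n k = {m. length m = n \<and> meander k m \<and> amplitude k m \<le> int L}"

(* reflection exchanging e_1 and e_3 *)
definition reflect_idx :: "3 \<Rightarrow> 3" where
  "reflect_idx i = (if i = 1 then 1 else if i = 2 then 3 else 2)"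

fun reflect_step :: "step \<Rightarrow> step" where
  "reflect_step (Fwd i) = Bwd (reflect_idx i)"
| "reflect_step (Bwd i) = Fwd (reflect_idx i)"

(* Omega L n k is Omega_{n,k}; Inl marks a meander and Inr a forward path.  Paths returned by a
   smaller instance are fed into the next one: first k + 1 (or the reflection when k = H), then k
   (try_level), then k - 1 (try_down).  The value is unspecified on lists that are empty or do
   not start with s_1 or s_2; these do not occur in fwd_paths L (Suc n) k. *)
fun Omega :: "nat \<Rightarrow> nat \<Rightarrow> int \<Rightarrow> step list \<Rightarrow> mstep list + step list" where
  "Omega L 0 k p = (if k = 0 then Inl [] else Inr [])"
| "Omega L (Suc n) k p =
     (let H = int (L div 2);
          p' = tl p;
          try_down = (\<lambda>v. case Omega L n (k - 1) v of
              Inl m \<Rightarrow> Inl (Down # m)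
            | Inr w \<Rightarrow> Inr (flip_to_fwd (Bwd 1 # w)));
          try_level = (\<lambda>u. case Omega L n k u of
              Inl m \<Rightarrow> Inl (Level # m)
            | Inr v \<Rightarrow> try_down v)
      in if p \<noteq> [] \<and> hd p = Fwd 2 then Inr (flip_to_fwd (Bwd 3 # p'))
         else if p \<noteq> [] \<and> hd p = Fwd 1 then
           (if k < H then
              (case Omega L n (k + 1) p' of
                 Inl m \<Rightarrow> Inl (Up # m)
               | Inr u \<Rightarrow> try_level u)
            else
              (let r = flip_to_fwd (map reflect_step p')
               in if odd L then try_level r else try_down r))
         else undefined)"

lemma fwd_paths_neg:
  assumes "k < 0"
  shows "fwd_paths L n k = {}"
proof -
  have ne: "(1::3) \<noteq> 2" "(1::3) \<noteq> 3" "(1::3) - 1 \<noteq> 1"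
    by simp_all
  have "start_pt L k \<notin> tri L"
  proof
    assume "start_pt L k \<in> tri L"
    then obtain x1 x2 x3 where
      eq: "start_pt L k = int x1 *s unit_vec 1 + int x2 *s unit_vec 2 + int x3 *s unit_vec 3"
      unfolding tri_def by blast
    have "start_pt L k $ 1 = k"
      using ne by (simp add: start_pt_def fwd_vec_def unit_vec_def axis_def)
    moreover have "start_pt L k $ 1 = int x1"
      unfolding eq using ne by (simp add: unit_vec_def axis_def)
    ultimately show False
      using assms by simp
  qed
  then show ?thesis
    by (auto simp: fwd_paths_def fwd_path_def tri_path_def intro!: bexI[of _ 0])
qed

end

(* Every flip trades a pair (forward, backward) for a pair (backward, forward) bijectively, without
   leaving the triangle, so moving the backward steps, last one first, to the right end and flipping them
   there gives a normal form that is invariant under all flips.  This normal form is W_n, and it is a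
   bijection on the paths with a given direction vector.

   A path counted by G_n(k) starts with s_1 or s_2, and a path from O + (k-1)s_1 with direction vector
   BF...F starts with the opposite of s_1 or s_3.  The opposite of s_3 followed by a path from
   O + k s_1 + s_2 is matched with s_2 followed by the same path.  A path starting with s_1 gives an
   element of G_(n-1)(k+1) (or of G_(n-1)(L-k-1) by reflection), and the bijections for n-1 lower
   the index down to k-2, each time splitting off the meanders with one given first step. *)
theory Submission
  imports Defs
begin

section \<open>The map W\<close>

text \<open>The normal form of \<open>Bwd i\<close> followed by a forward path. On its way to the
  right the backward step commutes with \<open>Fwd j\<close> for j \<noteq> i, while
  \<open>Bwd i\<close>, \<open>Fwd i\<close> turns into \<open>Fwd (i + 1)\<close>,
  \<open>Bwd (i + 1)\<close>; at the end \<open>Bwd i\<close> flips to \<open>Fwd (i + 1)\<close>.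
  The last equation is a junk value, never reached on forward paths.\<close>

fun push_bwd :: "3 \<Rightarrow> step list \<Rightarrow> step list" where
  "push_bwd i [] = [Fwd (i + 1)]"
| "push_bwd i (Fwd j # q) =
     (if i = j then Fwd (i + 1) # push_bwd (i + 1) q else Fwd j # push_bwd i q)"
| "push_bwd i (Bwd j # q) = undefined"

fun fwd_nf :: "step list \<Rightarrow> step list" where
  "fwd_nf [] = []"
| "fwd_nf (Fwd i # p) = Fwd i # fwd_nf p"
| "fwd_nf (Bwd i # p) = push_bwd i (fwd_nf p)"

abbreviation all_fwd :: "step list \<Rightarrow> bool" where
  "all_fwd p \<equiv> (\<forall>s\<in>set p. is_fwd s)"

section \<open>The normal form is reached by flips and invariant under them\<close>

lemma is_fwd_iff: "is_fwd s \<longleftrightarrow> (\<exists>i. s = Fwd i)"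
  by (cases s) auto

lemma push_bwd_fwd: "all_fwd q \<Longrightarrow> all_fwd (push_bwd i q) \<and> length (push_bwd i q) = Suc (length q)"
  by (induction i q rule: push_bwd.induct) auto

lemma fwd_nf_fwd: "all_fwd (fwd_nf p) \<and> length (fwd_nf p) = length p"
  by (induction p rule: fwd_nf.induct) (auto simp: push_bwd_fwd)

lemma fwd_nf_id: "all_fwd p \<Longrightarrow> fwd_nf p = p"
  by (induction p rule: fwd_nf.induct) auto

lemma fwd_nf_append_cong: "fwd_nf p = fwd_nf q \<Longrightarrow> fwd_nf (r @ p) = fwd_nf (r @ q)"
  by (induction r rule: fwd_nf.induct) auto

text \<open>Without the prefix, each of the three rules is one defining equation of
  \<open>push_bwd\<close>, with carried index k, k - 1 and i - 1 respectively.\<close>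

lemma fwd_nf_flip1: "flip1 p q \<Longrightarrow> fwd_nf p = fwd_nf q"
  by (induction rule: flip1.induct) (auto intro!: fwd_nf_append_cong)

lemma fwd_nf_flips: "flip\<^sup>*\<^sup>* p q \<Longrightarrow> fwd_nf p = fwd_nf q"
  by (induction rule: rtranclp_induct) (auto simp: flip_def dest: fwd_nf_flip1)

lemma flip1_Cons: "flip1 p q \<Longrightarrow> flip1 (s # p) (s # q)"
proof (induction rule: flip1.induct)
  case (swap_diff j k p q)
  then show ?case using flip1.swap_diff[of j k "s # p" q] by simp
next
  case (swap_same p k q)
  then show ?case using flip1.swap_same[of "s # p" k q] by simp
next
  case (last_step p i)
  then show ?case using flip1.last_step[of "s # p" i] by simp
qed

lemma flips_Cons: "flip\<^sup>*\<^sup>* p q \<Longrightarrow> flip\<^sup>*\<^sup>* (s # p) (s # q)"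
  by (induction rule: rtranclp_induct)
    (auto simp: flip_def intro: flip1_Cons rtranclp.rtrancl_into_rtrancl)

lemma flips_push_bwd: "all_fwd q \<Longrightarrow> flip\<^sup>*\<^sup>* (Bwd i # q) (push_bwd i q)"
proof (induction i q rule: push_bwd.induct)
  case (1 i)
  have "flip [Bwd i] [Fwd (i + 1)]"
    using flip1.last_step[of "[]" "i + 1"] by (simp add: flip_def)
  then show ?case by auto
next
  case (2 i j q)
  show ?case
  proof (cases "i = j")
    case True
    \<comment> \<open>The rule \<open>swap_same\<close> is read from right to left, with i + 1 for
      its k.\<close>
    have "flip (Bwd i # Fwd j # q) (Fwd (i + 1) # Bwd (i + 1) # q)"
      using flip1.swap_same[of "[]" "i + 1" q] True by (simp add: flip_def)
    with 2 True show ?thesis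
      by (auto intro: converse_rtranclp_into_rtranclp flips_Cons)
  next
    case False
    have "flip (Bwd i # Fwd j # q) (Fwd j # Bwd i # q)"
      using flip1.swap_diff[of j i "[]" q] False by (simp add: flip_def)
    with 2 False show ?thesis
      by (auto intro: converse_rtranclp_into_rtranclp flips_Cons)
  qed
qed auto

lemma flips_fwd_nf: "flip\<^sup>*\<^sup>* p (fwd_nf p)"
proof (induction p rule: fwd_nf.induct)
  case (3 i p)
  then show ?case
    using flips_Cons[of p "fwd_nf p" "Bwd i"] flips_push_bwd[of "fwd_nf p" i] fwd_nf_fwd
    by (auto intro: rtranclp_trans)
qed (auto intro: flips_Cons)

lemma flip_to_fwd_eq: "flip_to_fwd p = fwd_nf p"
  unfolding flip_to_fwd_def
proof (rule the_equality)
  show "flip\<^sup>*\<^sup>* p (fwd_nf p) \<and> all_fwd (fwd_nf p)"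
    using flips_fwd_nf fwd_nf_fwd by blast
  show "q = fwd_nf p" if "flip\<^sup>*\<^sup>* p q \<and> all_fwd q" for q
    using that fwd_nf_flips[of p q] fwd_nf_id[of q] by simp
qed

text \<open>After meeting \<open>Fwd i\<close> the first output step has the new carried index;
  after a commutation its index differs from the carried one. The induction recovers the carried
  index from the output tail, and comparing it with the output head then tells which case
  occurred.\<close>

lemma push_bwd_inj:
  "\<lbrakk>all_fwd q; all_fwd q'; push_bwd i q = push_bwd i' q'\<rbrakk> \<Longrightarrow> i = i' \<and> q = q'"
proof (induction i q arbitrary: i' q' rule: push_bwd.induct)
  case (1 i)
  then have "length (push_bwd i' q') = Suc 0"
    by (metis length_Cons list.size(3) push_bwd.simps(1))
  then have "q' = []"
    using push_bwd_fwd[of q' i'] 1(2) by simp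
  with 1(3) show ?case by simp
next
  case (2 i j q)
  have "length q' = length (Fwd j # q)"
    using push_bwd_fwd[OF 2(3), of i] push_bwd_fwd[OF 2(4), of i'] 2(5) by (metis nat.inject)
  then obtain j' r where q': "q' = Fwd j' # r" "all_fwd r"
    using 2(4) by (cases q') (auto simp: is_fwd_iff)
  have q: "all_fwd q" using 2(3) by simp
  show ?case
  proof (cases "i = j")
    case True
    show ?thesis
      \<comment> \<open>\<open>i' + 1\<close> and \<open>i'\<close> are the two possible carried
        indices of the other list after its first step.\<close>
      using 2(1)[OF True q q'(2), of "i' + 1"] 2(1)[OF True q q'(2), of i'] 2(5) True q'
      by (cases "i' = j'") auto
  next
    case False
    show ?thesis
      using 2(2)[OF False q q'(2), of "i' + 1"] 2(2)[OF False q q'(2), of i'] 2(5) False q'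
      by (cases "i' = j'") auto
  qed
qed auto

text \<open>The flips are undone from the right end: a last step \<open>Fwd a\<close> comes from
  \<open>Bwd (a - 1)\<close>, and then \<open>Fwd a\<close> in front of \<open>Bwd b\<close> is
  undone by the same-index rule if a = b and by commutation otherwise.\<close>

lemma push_bwd_surj:
  "\<lbrakk>all_fwd q; length q = Suc n\<rbrakk> \<Longrightarrow> \<exists>i r. all_fwd r \<and> length r = n \<and> push_bwd i r = q"
proof (induction n arbitrary: q)
  case 0
  then obtain a where "q = [Fwd a]"
    by (cases q) (auto simp: is_fwd_iff)
  then have "push_bwd (a - 1) [] = q" by simp
  then show ?case by (intro exI[of _ "a - 1"] exI[of _ "[]"]) simp
next
  case (Suc n)
  then obtain a q' where q: "q = Fwd a # q'" "all_fwd q'" "length q' = Suc n"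
    by (cases q) (auto simp: is_fwd_iff)
  then obtain b r where r: "all_fwd r" "length r = n" "push_bwd b r = q'"
    using Suc.IH by blast
  show ?case
  proof (cases "a = b")
    case True
    then have "push_bwd (a - 1) (Fwd (a - 1) # r) = q" using q r by simp
    then show ?thesis using r by (intro exI[of _ "a - 1"] exI[of _ "Fwd (a - 1) # r"]) simp
  next
    case False
    then have "push_bwd b (Fwd a # r) = q" using q r by simp
    then show ?thesis using r by (intro exI[of _ b] exI[of _ "Fwd a # r"]) simp
  qed
qed

text \<open>\<open>map is_fwd p\<close> is the direction vector. It decides at each position whether
  the step is copied or pushed, so the steps can be recovered one by one from the left.\<close>

lemma fwd_nf_inj: "\<lbrakk>map is_fwd p = map is_fwd p'; fwd_nf p = fwd_nf p'\<rbrakk> \<Longrightarrow> p = p'"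
proof (induction p arbitrary: p' rule: fwd_nf.induct)
  case (2 i p)
  then show ?case by (cases p' rule: fwd_nf.cases) auto
next
  case (3 i p)
  then obtain j r where r: "p' = Bwd j # r"
    by (cases p' rule: fwd_nf.cases) auto
  with 3 push_bwd_inj[of "fwd_nf p" "fwd_nf r" i j] show ?case
    by (auto simp: fwd_nf_fwd)
qed auto

lemma fwd_nf_surj:
  "\<lbrakk>all_fwd q; length q = length d\<rbrakk> \<Longrightarrow> \<exists>p. map is_fwd p = d \<and> fwd_nf p = q"
proof (induction d arbitrary: q)
  case (Cons b d)
  show ?case
  proof (cases b)
    case True
    from Cons.prems obtain a q' where q: "q = Fwd a # q'" "all_fwd q'" "length q' = length d"
      by (cases q) (auto simp: is_fwd_iff)
    with Cons.IH obtain p where "map is_fwd p = d" "fwd_nf p = q'" by blast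
    then show ?thesis using True q by (intro exI[of _ "Fwd a # p"]) simp
  next
    case False
    obtain i r where r: "all_fwd r" "length r = length d" "push_bwd i r = q"
      using push_bwd_surj[of q "length d"] Cons.prems by auto
    with Cons.IH obtain p where "map is_fwd p = d" "fwd_nf p = r" by blast
    then show ?thesis using False r by (intro exI[of _ "Bwd i # p"]) simp
  qed
qed auto

section \<open>Paths in the triangle\<close>

lemma tri_iff: "z \<in> tri L \<longleftrightarrow> 0 \<le> z $ 1 \<and> 0 \<le> z $ 2 \<and> 0 \<le> z $ 3 \<and> z $ 1 + z $ 2 + z $ 3 = int L"
proof
  assume "z \<in> tri L"
  then show "0 \<le> z $ 1 \<and> 0 \<le> z $ 2 \<and> 0 \<le> z $ 3 \<and> z $ 1 + z $ 2 + z $ 3 = int L"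
    by (auto simp: tri_def unit_vec_def axis_def)
next
  assume z: "0 \<le> z $ 1 \<and> 0 \<le> z $ 2 \<and> 0 \<le> z $ 3 \<and> z $ 1 + z $ 2 + z $ 3 = int L"
  show "z \<in> tri L"
    unfolding tri_def
    using z
    by (intro CollectI exI[of _ "nat (z $ 1)"] exI[of _ "nat (z $ 2)"] exI[of _ "nat (z $ 3)"])
      (auto simp: vec_eq_iff forall_3 unit_vec_def axis_def)
qed

lemma fwd_vec_nth: "fwd_vec i $ j = (if j = i then 1 else if j = i - 1 then - 1 else 0)"
  by (auto simp: fwd_vec_def unit_vec_def axis_def)

lemma three_arith [simp]: "(1::3) - 1 = 3" "(2::3) - 1 = 1" "(3::3) - 1 = 2"
  "(1::3) + 1 = 2" "(2::3) + 1 = 3" "(3::3) + 1 = 1"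
  by simp_all

lemma start_pt_nth [simp]:
  "start_pt L k $ 1 = k" "start_pt L k $ 2 = 0" "start_pt L k $ 3 = int L - k"
  by (simp_all add: start_pt_def fwd_vec_nth unit_vec_def axis_def)

lemma tri_path_Nil [simp]: "tri_path L z [] \<longleftrightarrow> z \<in> tri L"
  by (simp add: tri_path_def)

lemma ball_upto_Suc: "(\<forall>j\<in>{0..Suc n}. P j) \<longleftrightarrow> P 0 \<and> (\<forall>j\<in>{0..n}. P (Suc j))"
  by (auto simp: Ball_def) (metis Suc_le_mono not0_implies_Suc)

lemma tri_path_Cons [simp]:
  "tri_path L z (s # p) \<longleftrightarrow> z \<in> tri L \<and> tri_path L (z + step_vec s) p"
  by (simp add: tri_path_def ball_upto_Suc add.assoc del: atLeastAtMost_iff)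

lemma tri_path_start: "tri_path L z p \<Longrightarrow> z \<in> tri L"
  by (cases p) auto

text \<open>Both steps take one unit from coordinate i, so both are possible exactly when that
  coordinate is positive.\<close>

lemma tri_last_flip: "z \<in> tri L \<Longrightarrow> z + fwd_vec (i + 1) \<in> tri L \<longleftrightarrow> z - fwd_vec i \<in> tri L"
  using exhaust_3[of i] by (auto simp: tri_iff fwd_vec_nth)

text \<open>For i \<noteq> j neither step raises the coordinate lowered by the other. If the common
  endpoint lies in the triangle, both lowered coordinates are therefore positive at z, and both
  intermediate points lie in the triangle.\<close>

lemma tri_swap_diff:
  "\<lbrakk>z \<in> tri L; i \<noteq> j; z - fwd_vec i + fwd_vec j \<in> tri L\<rbrakk> \<Longrightarrow>
     z + fwd_vec j \<in> tri L \<longleftrightarrow> z - fwd_vec i \<in> tri L"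
  using exhaust_3[of i] exhaust_3[of j] by (auto simp: tri_iff fwd_vec_nth)

lemma tri_path_push_bwd:
  "all_fwd q \<Longrightarrow> tri_path L z (push_bwd i q) \<longleftrightarrow> tri_path L z (Bwd i # q)"
proof (induction i q arbitrary: z rule: push_bwd.induct)
  case (1 i)
  then show ?case using tri_last_flip[of z L i] by auto
next
  case (2 i j q)
  show ?case
  proof (cases "i = j")
    case True
    \<comment> \<open>Both pairs of steps return to z, so only the intermediate point
      changes.\<close>
    then show ?thesis using 2 tri_last_flip[of z L i] by auto
  next
    case False
    have "tri_path L z (push_bwd i (Fwd j # q)) \<longleftrightarrow>
        z \<in> tri L \<and> z + fwd_vec j \<in> tri L \<and> tri_path L (z - fwd_vec i + fwd_vec j) q"
      using 2 False by (simp add: diff_add_eq)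
    then show ?thesis
      using False tri_swap_diff[of z L i j] tri_path_start[of L "z - fwd_vec i + fwd_vec j" q]
      by auto
  qed
qed auto

lemma tri_path_fwd_nf: "tri_path L z (fwd_nf p) \<longleftrightarrow> tri_path L z p"
proof (induction p arbitrary: z rule: fwd_nf.induct)
  case (3 i p)
  then show ?case using tri_path_push_bwd[of "fwd_nf p" L z i] fwd_nf_fwd by simp
qed auto

lemma bij_betw_flip_to_fwd:
  "bij_betw flip_to_fwd {p. map is_fwd p = d \<and> tri_path L z p}
     {q. length q = length d \<and> fwd_path L z q}"
proof (rule bij_betwI')
  fix q assume "q \<in> {q. length q = length d \<and> fwd_path L z q}"
  then show "\<exists>p\<in>{p. map is_fwd p = d \<and> tri_path L z p}. q = flip_to_fwd p"
    using fwd_nf_surj[of q d] by (auto simp: flip_to_fwd_eq fwd_path_def tri_path_fwd_nf)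
qed (auto simp: flip_to_fwd_eq fwd_path_def tri_path_fwd_nf fwd_nf_fwd intro: fwd_nf_inj)

section \<open>Reflection\<close>

definition reflect_pt :: "int ^ 3 \<Rightarrow> int ^ 3" where
  "reflect_pt z = (\<chi> i. if i = 1 then z $ 3 else if i = 2 then z $ 2 else z $ 1)"

lemma reflect_pt_nth [simp]:
  "reflect_pt z $ 1 = z $ 3" "reflect_pt z $ 2 = z $ 2" "reflect_pt z $ 3 = z $ 1"
  by (simp_all add: reflect_pt_def)

lemma reflect_pt_tri [simp]: "reflect_pt z \<in> tri L \<longleftrightarrow> z \<in> tri L"
  by (auto simp: tri_iff)

text \<open>Exchanging e_1 and e_3 reverses orientation, so forward and backward steps trade
  places.\<close>

lemma reflect_pt_step: "reflect_pt z + step_vec (reflect_step s) = reflect_pt (z + step_vec s)"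
proof (cases s)
  case (Fwd i)
  then show ?thesis
    using exhaust_3[of i] by (auto simp: vec_eq_iff forall_3 reflect_idx_def fwd_vec_nth)
next
  case (Bwd i)
  then show ?thesis
    using exhaust_3[of i] by (auto simp: vec_eq_iff forall_3 reflect_idx_def fwd_vec_nth)
qed

lemma reflect_step_invol [simp]: "reflect_step (reflect_step s) = s"
  by (cases s) (use exhaust_3 in \<open>auto simp: reflect_idx_def\<close>)

lemma is_fwd_reflect_step [simp]: "is_fwd (reflect_step s) \<longleftrightarrow> \<not> is_fwd s"
  by (cases s) auto

lemma tri_path_reflect: "tri_path L (reflect_pt z) (map reflect_step p) \<longleftrightarrow> tri_path L z p"
  by (induction p arbitrary: z) (auto simp: reflect_pt_step)

lemma map_is_fwd_replicate:
  "map is_fwd p = replicate n b \<longleftrightarrow> length p = n \<and> (\<forall>s\<in>set p. is_fwd s = b)"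
  by (auto simp: list_eq_iff_nth_eq all_set_conv_all_nth)

lemma reflect_start_pt: "reflect_pt (start_pt L k) = start_pt L (int L - k)"
  by (simp add: vec_eq_iff forall_3)

text \<open>Reflection yields paths with direction vector B...B from the mirrored start point, and W
  makes them forward again.\<close>

lemma bij_betw_reflect:
  "bij_betw (\<lambda>p. flip_to_fwd (map reflect_step p)) (fwd_paths L n k) (fwd_paths L n (int L - k))"
proof -
  let ?B = "{p. map is_fwd p = replicate n False \<and> tri_path L (start_pt L (int L - k)) p}"
  have "bij_betw (map reflect_step) (fwd_paths L n k) ?B"
    by (rule bij_betw_byWitness[where f' = "map reflect_step"])
      (use tri_path_reflect[of L "start_pt L (int L - k)"] tri_path_reflect[of L "start_pt L k"] in
        \<open>auto simp: fwd_paths_def fwd_path_def reflect_start_pt map_is_fwd_replicate o_def\<close>)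
  moreover have "bij_betw flip_to_fwd ?B (fwd_paths L n (int L - k))"
    using bij_betw_flip_to_fwd[of "replicate n False"] by (simp add: fwd_paths_def)
  ultimately show ?thesis
    using bij_betw_trans by (fastforce simp: o_def)
qed

section \<open>Meanders\<close>

lemma height_at_0 [simp]: "height_at k m 0 = k"
  by (simp add: height_at_def)

lemma height_at_Cons [simp]:
  "height_at k (s # m) (Suc j) = height_at (k + mstep_height s) m j"
  by (simp add: height_at_def)

text \<open>Replaces the maximum by conditions on single positions, which can be split off with the
  first step.\<close>

lemma amplitude_le_iff:
  "amplitude k m \<le> L \<longleftrightarrow>
     (\<forall>j\<in>{0..length m}. 2 * height_at k m j \<le> L) \<and>
     (\<forall>j<length m. m ! j = Level \<longrightarrow> 2 * height_at k m j + 1 \<le> L)"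
proof -
  have le: "height_at k m j \<le> max_height k m" if "j \<le> length m" for j
    using that by (auto simp: max_height_def)
  have "max_height k m \<in> height_at k m ` {0..length m}"
    unfolding max_height_def by (rule Max_in) auto
  then obtain i where i: "i \<le> length m" "height_at k m i = max_height k m"
    by auto
  show ?thesis
  proof
    assume a: "amplitude k m \<le> L"
    \<comment> \<open>A level step below the maximum h has height at most h - 1, so it costs less
      than 2h; only one at height h needs the extra 1.\<close>
    have "2 * height_at k m j + 1 \<le> L" if "j < length m" "m ! j = Level" for j
      using that a le[of j] by (cases "height_at k m j = max_height k m")
        (fastforce simp: amplitude_def split: if_splits)+
    moreover have "2 * height_at k m j \<le> L" if "j \<le> length m" for j
      using that a le[of j] by (simp add: amplitude_def split: if_splits)
    ultimately show "(\<forall>j\<in>{0..length m}. 2 * height_at k m j \<le> L) \<and>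
     (\<forall>j<length m. m ! j = Level \<longrightarrow> 2 * height_at k m j + 1 \<le> L)" by auto
  next
    assume "(\<forall>j\<in>{0..length m}. 2 * height_at k m j \<le> L) \<and>
     (\<forall>j<length m. m ! j = Level \<longrightarrow> 2 * height_at k m j + 1 \<le> L)"
    then show "amplitude k m \<le> L"
      using i by (auto simp: amplitude_def) (metis atLeastAtMost_iff zero_le)
  qed
qed

lemma meanders_Nil: "[] \<in> meanders L n k \<longleftrightarrow> n = 0 \<and> k = 0"
  by (auto simp: meanders_def meander_def amplitude_le_iff)

lemma meanders_Cons:
  "s # m \<in> meanders L (Suc n) k \<longleftrightarrow>
     0 \<le> k \<and> 2 * k \<le> int L \<and> (s = Level \<longrightarrow> 2 * k + 1 \<le> int L) \<and>
     m \<in> meanders L n (k + mstep_height s)"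
  unfolding meanders_def meander_def amplitude_le_iff
  by (auto simp: ball_upto_Suc All_less_Suc2)

lemma meanders_empty: "k < 0 \<or> int L < 2 * k \<Longrightarrow> meanders L n k = {}"
  by (auto simp: meanders_def meander_def amplitude_le_iff) force+

lemma meanders_0: "meanders L 0 k = (if k = 0 then {[]} else {})"
proof -
  have "m \<in> meanders L 0 k \<longleftrightarrow> m = [] \<and> k = 0" for m
    by (cases m) (simp_all add: meanders_Nil, simp add: meanders_def)
  then show ?thesis by auto
qed

text \<open>\<open>Up\<close> and \<open>Down\<close> need no side condition, since the set of tails
  is empty once the height leaves the allowed range. \<open>Level\<close> is excluded exactly when
  2k = L.\<close>

lemma meanders_Suc:
  assumes "0 \<le> k" "2 * k \<le> int L"
  shows "meanders L (Suc n) k = Cons Up ` meanders L n (k + 1) \<union>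
     ((if 2 * k + 1 \<le> int L then Cons Level ` meanders L n k else {}) \<union>
      Cons Down ` meanders L n (k - 1))"
proof (intro set_eqI)
  fix m
  show "m \<in> meanders L (Suc n) k \<longleftrightarrow> m \<in> Cons Up ` meanders L n (k + 1) \<union>
     ((if 2 * k + 1 \<le> int L then Cons Level ` meanders L n k else {}) \<union>
      Cons Down ` meanders L n (k - 1))"
  proof (cases m)
    case Nil
    then show ?thesis by (auto simp: meanders_Nil)
  next
    case (Cons s m')
    then show ?thesis using assms
      by (cases s) (auto simp: meanders_Cons)
  qed
qed

section \<open>The recursion\<close>

text \<open>One stage of the recursion: \<open>f\<close> splits off meanders, which receive a first
  step by \<open>c\<close>, and the remaining paths are handed to the next stage
  \<open>g\<close>.\<close>

lemma bij_betw_case_sum: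
  assumes f: "bij_betw f A (M <+> B)" and g: "bij_betw g B (N <+> C)"
    and c: "inj_on c M" "c ` M \<inter> N = {}"
  shows "bij_betw (\<lambda>x. case f x of Inl m \<Rightarrow> Inl (c m) | Inr u \<Rightarrow> g u) A ((c ` M \<union> N) <+> C)"
proof -
  have h: "bij_betw (case_sum (\<lambda>m. Inl (c m)) g) (M <+> B) ((c ` M \<union> N) <+> C)"
  proof -
    have 1: "bij_betw (case_sum (\<lambda>m. Inl (c m)) g) (Inl ` M) (Inl ` c ` M)"
      using c(1) by (auto simp: bij_betw_def inj_on_def image_image)
    have 2: "bij_betw (case_sum (\<lambda>m. Inl (c m)) g) (Inr ` B) (N <+> C)"
      using g by (auto simp: bij_betw_def inj_on_def image_image)
    have "bij_betw (case_sum (\<lambda>m. Inl (c m)) g) (Inl ` M \<union> Inr ` B) (Inl ` c ` M \<union> (N <+> C))"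
      using c(2) by (intro bij_betw_combine 1 2) auto
    moreover have "Inl ` c ` M \<union> (N <+> C) = (c ` M \<union> N) <+> C"
      by auto
    ultimately show ?thesis by (simp add: Plus_def)
  qed
  show ?thesis
    using bij_betw_trans[OF f h] by (simp add: o_def)
qed

section \<open>Splitting paths by their first step\<close>

lemma fwd_path_Cons:
  "fwd_path L z (s # p) \<longleftrightarrow> z \<in> tri L \<and> is_fwd s \<and> fwd_path L (z + step_vec s) p"
  by (auto simp: fwd_path_def)

lemma start_pt_tri: "start_pt L k \<in> tri L \<longleftrightarrow> 0 \<le> k \<and> k \<le> int L"
  by (auto simp: tri_iff)

lemma start_pt_add: "start_pt L k + fwd_vec 1 = start_pt L (k + 1)"
  by (simp add: vec_eq_iff forall_3 fwd_vec_nth)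

lemma start_pt_diff: "start_pt L k - fwd_vec 1 = start_pt L (k - 1)"
  by (simp add: vec_eq_iff forall_3 fwd_vec_nth)

text \<open>This is s_1 + s_2 + s_3 = 0, and it makes rule (a) a matching between first steps
  \<open>Fwd 2\<close> and \<open>Bwd 3\<close>.\<close>

lemma start_pt_diff3: "start_pt L (k - 1) - fwd_vec 3 = start_pt L k + fwd_vec 2"
  by (simp add: vec_eq_iff forall_3 fwd_vec_nth)

lemma fwd_path_start: "fwd_path L z p \<Longrightarrow> z \<in> tri L"
  by (auto simp: fwd_path_def tri_path_start)

lemma fwd_paths_Suc:
  assumes "0 \<le> k" "k \<le> int L"
  shows "fwd_paths L (Suc n) k = Cons (Fwd 1) ` fwd_paths L n (k + 1) \<union>
     Cons (Fwd 2) ` {p. length p = n \<and> fwd_path L (start_pt L k + fwd_vec 2) p}"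
proof (intro set_eqI)
  fix q
  \<comment> \<open>s_3 lowers coordinate 2, which is 0 at the start point.\<close>
  have 3: "start_pt L k + fwd_vec 3 \<notin> tri L"
    by (simp add: tri_iff fwd_vec_nth)
  show "q \<in> fwd_paths L (Suc n) k \<longleftrightarrow> q \<in> Cons (Fwd 1) ` fwd_paths L n (k + 1) \<union>
     Cons (Fwd 2) ` {p. length p = n \<and> fwd_path L (start_pt L k + fwd_vec 2) p}"
  proof (cases q)
    case Nil
    then show ?thesis by (auto simp: fwd_paths_def)
  next
    case (Cons s p)
    show ?thesis
    proof (cases s)
      case (Fwd i)
      then show ?thesis
        using Cons assms exhaust_3[of i] 3 fwd_path_start[of L "start_pt L k + fwd_vec 3" p]
        by (auto simp: fwd_path_Cons start_pt_tri start_pt_add fwd_paths_def)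
    qed (auto simp: Cons fwd_path_Cons fwd_paths_def)
  qed
qed

lemma bwd_paths_Suc:
  assumes "k \<le> int L"
  shows "{p. map is_fwd p = False # replicate n True \<and> tri_path L (start_pt L (k - 1)) p} =
     Cons (Bwd 1) ` fwd_paths L n (k - 2) \<union>
     Cons (Bwd 3) ` {p. length p = n \<and> fwd_path L (start_pt L k + fwd_vec 2) p}"
proof (intro set_eqI)
  fix q
  have 2: "start_pt L (k - 1) - fwd_vec 2 \<notin> tri L"
    by (simp add: tri_iff fwd_vec_nth)
  \<comment> \<open>The right-hand side does not mention the start point O + (k-1)s_1; this fact and
    the next recover it from the point after the first step.\<close>
  have 3: "start_pt L (k - 1) \<in> tri L" if "start_pt L k + fwd_vec 2 \<in> tri L"
    using that by (auto simp add: tri_iff fwd_vec_nth)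
  have 1: "start_pt L (k - 1) \<in> tri L" if "start_pt L (k - 2) \<in> tri L"
    using that assms by (auto simp add: start_pt_tri)
  show "q \<in> {p. map is_fwd p = False # replicate n True \<and> tri_path L (start_pt L (k - 1)) p} \<longleftrightarrow>
    q \<in> Cons (Bwd 1) ` fwd_paths L n (k - 2) \<union>
     Cons (Bwd 3) ` {p. length p = n \<and> fwd_path L (start_pt L k + fwd_vec 2) p}"
  proof (cases q)
    case Nil
    then show ?thesis by auto
  next
    case (Cons s p)
    show ?thesis
    proof (cases s)
      case (Bwd i)
      then show ?thesis
        using Cons exhaust_3[of i] 1 2 3 tri_path_start[of L _ p]
        by (auto simp: start_pt_diff start_pt_diff3 fwd_paths_def fwd_path_def map_is_fwd_replicate)
    qed (auto simp: Cons)
  qed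
qed

lemma bij_betw_first_bwd:
  assumes "k \<le> int L"
  shows "bij_betw flip_to_fwd (Cons (Bwd 1) ` fwd_paths L n (k - 2) \<union>
     Cons (Bwd 3) ` {p. length p = n \<and> fwd_path L (start_pt L k + fwd_vec 2) p})
     (fwd_paths L (Suc n) (k - 1))"
  using bij_betw_flip_to_fwd[of "False # replicate n True" L "start_pt L (k - 1)"]
  unfolding bwd_paths_Suc[OF assms] by (simp add: fwd_paths_def)

lemma bij_betw_Inr: "bij_betw f A B \<Longrightarrow> bij_betw (\<lambda>x. Inr (f x)) A ({} <+> B)"
  by (auto simp: bij_betw_def inj_on_def)

text \<open>Stage (e), then (d), then (b) with (c), as separate functions, so that each stage gets
  its own bijection.\<close>

definition try_down :: "nat \<Rightarrow> nat \<Rightarrow> int \<Rightarrow> step list \<Rightarrow> mstep list + step list" where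
  "try_down L n k v = (case Omega L n (k - 1) v of
     Inl m \<Rightarrow> Inl (Down # m) | Inr w \<Rightarrow> Inr (flip_to_fwd (Bwd 1 # w)))"

definition try_level :: "nat \<Rightarrow> nat \<Rightarrow> int \<Rightarrow> step list \<Rightarrow> mstep list + step list" where
  "try_level L n k u = (case Omega L n k u of
     Inl m \<Rightarrow> Inl (Level # m) | Inr v \<Rightarrow> try_down L n k v)"

definition try_s1 :: "nat \<Rightarrow> nat \<Rightarrow> int \<Rightarrow> step list \<Rightarrow> mstep list + step list" where
  "try_s1 L n k p =
     (if k < int (L div 2) then
        (case Omega L n (k + 1) p of Inl m \<Rightarrow> Inl (Up # m) | Inr u \<Rightarrow> try_level L n k u)
      else if odd L then try_level L n k (flip_to_fwd (map reflect_step p))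
      else try_down L n k (flip_to_fwd (map reflect_step p)))"

lemma Omega_Cons:
  "Omega L (Suc n) k (Fwd 1 # p) = try_s1 L n k p"
  "Omega L (Suc n) k (Fwd 2 # p) = Inr (flip_to_fwd (Bwd 3 # p))"
  by (simp_all add: try_s1_def try_level_def try_down_def Let_def split: sum.split)

declare Omega.simps(2) [simp del]

(* For negative k both sides are empty; including them removes the boundary cases
   k - 1 < 0 from the induction. *)
lemma bij_betw_Omega:
  "k \<le> int (L div 2) \<Longrightarrow>
     bij_betw (Omega L n k) (fwd_paths L n k) (meanders L n k <+> fwd_paths L n (k - 1))"
proof (induction n arbitrary: k)
  case 0
  \<comment> \<open>The empty path goes to the empty meander for k = 0 and to the empty path in
    G_0(k-1) for k \<ge> 1.\<close>
  have "fwd_paths L 0 j = (if 0 \<le> j \<and> j \<le> int L then {[]} else {})" for j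
    by (auto simp: fwd_paths_def fwd_path_def start_pt_tri)
  with 0 show ?case
    by (auto simp: meanders_0 bij_betw_def)
next
  case (Suc n)
  show ?case
  proof (cases "0 \<le> k")
    case False
    then show ?thesis
      by (simp add: meanders_empty fwd_paths_neg Plus_def bij_betw_def)
  next
    case k0: True
    \<comment> \<open>\<open>W1\<close> and \<open>W3\<close> partition G_(n+1)(k-1): paths in
      \<open>W1\<close> come out of stage (e), those in \<open>W3\<close> out of rule (a).\<close>
    define W1 where "W1 = (\<lambda>w. flip_to_fwd (Bwd 1 # w)) ` fwd_paths L n (k - 2)"
    define P2 where "P2 = {p. length p = n \<and> fwd_path L (start_pt L k + fwd_vec 2) p}"
    define W3 where "W3 = (\<lambda>w. flip_to_fwd (Bwd 3 # w)) ` P2"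
    have kL: "k \<le> int L" "2 * k \<le> int L"
      using Suc.prems by linarith+
    have bij: "bij_betw flip_to_fwd (Cons (Bwd 1) ` fwd_paths L n (k - 2) \<union> Cons (Bwd 3) ` P2)
       (fwd_paths L (Suc n) (k - 1))"
      unfolding P2_def by (rule bij_betw_first_bwd[OF kL(1)])
    note inj = bij_betw_imp_inj_on[OF bij]
    have W13: "W1 \<union> W3 = fwd_paths L (Suc n) (k - 1)"
      unfolding W1_def W3_def bij_betw_imp_surj_on[OF bij, symmetric]
      by (simp only: image_Un image_image)
    have W1: "bij_betw (\<lambda>w. flip_to_fwd (Bwd 1 # w)) (fwd_paths L n (k - 2)) W1"
      unfolding W1_def by (intro inj_on_imp_bij_betw inj_onI) (drule inj_onD[OF inj]; simp)
    have W3: "bij_betw (\<lambda>w. flip_to_fwd (Bwd 3 # w)) P2 W3"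
      unfolding W3_def by (intro inj_on_imp_bij_betw inj_onI) (drule inj_onD[OF inj]; simp)
    have disj: "W1 \<inter> W3 = {}"
    proof -
      have "flip_to_fwd (Bwd 1 # w) \<noteq> flip_to_fwd (Bwd 3 # w')"
        if "w \<in> fwd_paths L n (k - 2)" "w' \<in> P2" for w w'
        using that inj_onD[OF inj, of "Bwd 1 # w" "Bwd 3 # w'"] by auto
      then show ?thesis
        unfolding W1_def W3_def by blast
    qed
    have IH1: "bij_betw (Omega L n (k - 1)) (fwd_paths L n (k - 1))
       (meanders L n (k - 1) <+> fwd_paths L n (k - 2))"
      using Suc.IH[of "k - 1"] Suc.prems by simp
    \<comment> \<open>The stages are assembled from the last to the first, each adding the meanders
      with one more possible first step.\<close>
    have down: "bij_betw (try_down L n k) (fwd_paths L n (k - 1))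
       (Cons Down ` meanders L n (k - 1) <+> W1)"
      using bij_betw_case_sum[OF IH1 bij_betw_Inr[OF W1], of "Cons Down"]
      by (simp add: try_down_def [abs_def])
    have level: "bij_betw (try_level L n k) (fwd_paths L n k)
       ((Cons Level ` meanders L n k \<union> Cons Down ` meanders L n (k - 1)) <+> W1)"
      unfolding try_level_def [abs_def]
      by (rule bij_betw_case_sum[OF Suc.IH down]) (use Suc.prems in auto)
    have s1: "bij_betw (try_s1 L n k) (fwd_paths L n (k + 1)) (meanders L (Suc n) k <+> W1)"
    proof (cases "k < int (L div 2)")
      case True
      then have "2 * k + 1 \<le> int L" by linarith
      have "bij_betw (try_s1 L n k) (fwd_paths L n (k + 1))
         ((Cons Up ` meanders L n (k + 1) \<union>
           (Cons Level ` meanders L n k \<union> Cons Down ` meanders L n (k - 1))) <+> W1)"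
        unfolding try_s1_def [abs_def] using True
        by (simp, intro bij_betw_case_sum[where B = "fwd_paths L n k"])
          (use Suc.IH[of "k + 1"] level in auto)
      then show ?thesis
        using \<open>2 * k + 1 \<le> int L\<close> by (simp add: meanders_Suc[OF k0 kL(2)])
    next
      case False
      with Suc.prems have k: "k = int (L div 2)" by simp
      \<comment> \<open>At k = H an \<open>Up\<close> step would give 2(k + 1) > L, so reflection
        can replace the first stage.\<close>
      then have up: "meanders L n (k + 1) = {}"
        by (intro meanders_empty disjI2) presburger
      have refl: "bij_betw (\<lambda>p. flip_to_fwd (map reflect_step p)) (fwd_paths L n (k + 1))
         (fwd_paths L n (int L - (k + 1)))"
        by (rule bij_betw_reflect)
      show ?thesis
      proof (cases "odd L")
        case True
        \<comment> \<open>For L = 2H + 1 the reflected index is again H, so the level stage takes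
          over.\<close>
        then have L: "int L - (k + 1) = k" "2 * k + 1 \<le> int L"
          unfolding k by (auto elim!: oddE)
        show ?thesis
          using bij_betw_trans[OF refl[unfolded L(1)] level] True False L(2)
          by (simp add: try_s1_def [abs_def] o_def meanders_Suc[OF k0 kL(2)] up)
      next
        case even: False
        \<comment> \<open>For L = 2H level steps at height H are excluded, and the reflected index H
          - 1 is just what the down stage expects.\<close>
        then have L: "int L - (k + 1) = k - 1" "\<not> 2 * k + 1 \<le> int L"
          unfolding k by (auto elim!: evenE)
        show ?thesis
          using bij_betw_trans[OF refl[unfolded L(1)] down] even False L(2)
          by (simp add: try_s1_def [abs_def] o_def meanders_Suc[OF k0 kL(2)] up)
      qed
    qed
    have 1: "bij_betw (Omega L (Suc n) k) (Cons (Fwd 1) ` fwd_paths L n (k + 1))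
       (meanders L (Suc n) k <+> W1)"
      using s1 by (auto simp: bij_betw_def inj_on_def image_image Omega_Cons)
    have 2: "bij_betw (Omega L (Suc n) k) (Cons (Fwd 2) ` P2) ({} <+> W3)"
      using bij_betw_Inr[OF W3] by (auto simp: bij_betw_def inj_on_def image_image Omega_Cons)
    have "bij_betw (Omega L (Suc n) k) (fwd_paths L (Suc n) k)
       ((meanders L (Suc n) k <+> W1) \<union> ({} <+> W3))"
      unfolding fwd_paths_Suc[OF k0 kL(1)] P2_def[symmetric]
      by (rule bij_betw_combine[OF 1 2]) (use disj in auto)
    moreover have "(meanders L (Suc n) k <+> W1) \<union> ({} <+> W3) =
        meanders L (Suc n) k <+> fwd_paths L (Suc n) (k - 1)"
      using W13 by auto
    ultimately show ?thesis by simp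
  qed
qed

theorem theorem19:
  fixes L n :: nat and k :: int
  assumes "0 \<le> k" and "k \<le> int (L div 2)"
  shows "bij_betw (Omega L n k) (fwd_paths L n k) (meanders L n k <+> fwd_paths L n (k - 1))"
  using assms(2) by (rule bij_betw_Omega)

end
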